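(* Let $\varphi\in C^\infty(\check{\mathcal M},\mathcal M)$ be a smooth embedding and let $\varrho\in C^\infty(\mathcal M,\check{\mathcal M})$ be a point reduction for $\varphi$. Then the differential of $\varrho$ is a left inverse to the differential of $\varphi$, i.e. $\mathrm d\varrho|_{\varphi(\check m)}\circ\mathrm d\varphi|_{\check m}=\mathrm{id}_{T_{\check m}\check{\mathcal M}}$ for all $\check m\in\check{\mathcal M}$. Consequently, $$R_{\mathrm{MPG}}:T\mathcal M\to T\check{\mathcal M},\qquad (m,v)\mapsto\big(\varrho(m),\mathrm d\varrho|_m(v)\big)$$ is a smooth reduction map for $\varphi$.
   Context: $\mathcal M$ and $\check{\mathcal M}$ are smooth manifolds. A smooth embedding is a smooth immersion that is a homeomorphism onto its image. A point reduction for $\varphi$ is a map $\varrho\in C^\infty(\mathcal M,\check{\mathcal M})$ with $\varrho\circ\varphi=\mathrm{id}_{\check{\mathcal M}}$. The differential of $\varphi$ on tangent bundles is $\mathrm d\varphi:T\check{\mathcal M}\to T\mathcal M$, $(\check m,\check v)\mapsto(\varphi(\check m),\mathrm d\varphi|_{\check m}(\check v))$. A reduction map for $\varphi$ is a map $R\in C^\infty(T\mathcal M,T\check{\mathcal M})$ of the form $R(m,v)=(\varrho(m),R|_m(v))$, with $\varrho\in C^\infty(\mathcal M,\check{\mathcal M})$ and $R|_m\in C^\infty(T_m\mathcal M,T_{\varrho(m)}\check{\mathcal M})$, satisfying the projection property $R\circ\mathrm d\varphi=\mathrm{id}_{T\check{\mathcal M}}$. *)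

theory Defs
  imports "HOL-Analysis.Analysis"
begin

section \<open>Model spaces\<close>

text \<open>The spaces \<open>\<real>\<^sup>n\<close>. Class \<open>euclidean_space\<close> demands a nonempty basis and so excludes
  \<open>\<real>\<^sup>0\<close>; the class below has the same axioms without that restriction, so that
  zero-dimensional manifolds are admitted.\<close>

class finite_dim_inner = real_inner +
  assumes finite_orthonormal_basis:
    "\<exists>B. finite B \<and> (\<forall>u\<in>B. \<forall>v\<in>B. inner u v = (if u = v then 1 else 0)) \<and>
         (\<forall>x. (\<forall>u\<in>B. inner x u = 0) \<longleftrightarrow> x = 0)"

subclass (in euclidean_space) finite_dim_inner
  by standard (metis finite_Basis inner_Basis euclidean_all_zero_iff)

instantiation unit :: finite_dim_inner
begin

definition "(x::unit) + y = ()"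
definition "(0::unit) = ()"
definition "scaleR (r::real) (x::unit) = ()"
definition "norm (x::unit) = (0::real)"
definition "sgn (x::unit) = ()"
definition "dist (x::unit) (y::unit) = (0::real)"
definition "inner (x::unit) (y::unit) = (0::real)"
definition uniformity_unit: "(uniformity :: (unit \<times> unit) filter) =
  (INF e\<in>{0 <..}. principal {(x, y). dist x y < e})"
definition open_unit: "open (U::unit set) \<longleftrightarrow>
  (\<forall>x\<in>U. eventually (\<lambda>(x', y). x' = x \<longrightarrow> y \<in> U) uniformity)"

instance
proof
  show "\<exists>B. finite B \<and> (\<forall>u\<in>B. \<forall>v\<in>B. inner u v = (if u = v then 1 else 0)) \<and>
         (\<forall>x::unit. (\<forall>u\<in>B. inner x u = 0) \<longleftrightarrow> x = 0)"
    by (rule exI[of _ "{}"]) auto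
qed (simp_all add: norm_unit_def dist_unit_def inner_unit_def uniformity_unit open_unit)

end


section \<open>Smooth functions between open sets of model spaces\<close>

text \<open>For open \<open>S\<close> in a finite-dimensional space this is the usual notion \<open>C\<^sup>k\<close>: all iterated
  directional derivatives of order at most \<open>k\<close> exist and are continuous.\<close>

fun Ck_on :: "nat \<Rightarrow> 'e::real_normed_vector set \<Rightarrow> ('e \<Rightarrow> 'f::real_normed_vector) \<Rightarrow> bool" where
  "Ck_on 0 S f \<longleftrightarrow> continuous_on S f"
| "Ck_on (Suc k) S f \<longleftrightarrow>
     (\<forall>x\<in>S. f differentiable (at x)) \<and> (\<forall>v. Ck_on k S (\<lambda>x. frechet_derivative f (at x) v))"

definition smooth_on :: "'e::real_normed_vector set \<Rightarrow> ('e \<Rightarrow> 'f::real_normed_vector) \<Rightarrow> bool" where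
  "smooth_on S f \<longleftrightarrow> (\<forall>k. Ck_on k S f)"


section \<open>Smooth manifolds and smooth maps\<close>

text \<open>A manifold is given by its topology and a smooth atlas, which need not be maximal. A chart is
  a pair of its domain \<open>U\<close> and its coordinate map \<open>c\<close>; values of \<open>c\<close> outside \<open>U\<close> are irrelevant, and
  the inverse chart is \<open>inv_into U c\<close>. The dimension is that of the model space \<^typ>\<open>'e\<close>.\<close>

record ('a, 'e) manifold =
  mtop :: "'a topology"
  charts :: "('a set \<times> ('a \<Rightarrow> 'e)) set"

abbreviation points :: "('a, 'e) manifold \<Rightarrow> 'a set" where
  "points M \<equiv> topspace (mtop M)"

definition smooth_manifold :: "('a, 'e::finite_dim_inner) manifold \<Rightarrow> bool" where
  "smooth_manifold M \<longleftrightarrow>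
     Hausdorff_space (mtop M) \<and> second_countable (mtop M) \<and>
     (\<forall>(U, c)\<in>charts M. openin (mtop M) U \<and> open (c ` U) \<and>
        homeomorphic_map (subtopology (mtop M) U) (top_of_set (c ` U)) c) \<and>
     (\<Union>(U, c)\<in>charts M. U) = points M \<and>
     (\<forall>(U, c)\<in>charts M. \<forall>(V, d)\<in>charts M. smooth_on (c ` (U \<inter> V)) (d \<circ> inv_into U c))"

definition smooth_map ::
  "('a, 'e::real_normed_vector) manifold \<Rightarrow> ('b, 'f::real_normed_vector) manifold \<Rightarrow> ('a \<Rightarrow> 'b) \<Rightarrow> bool"
  where
  "smooth_map M N F \<longleftrightarrow>
     continuous_map (mtop M) (mtop N) F \<and>
     (\<forall>(U, c)\<in>charts M. \<forall>(V, d)\<in>charts N.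
        smooth_on (c ` {x\<in>U. F x \<in> V}) (d \<circ> F \<circ> inv_into U c))"

definition open_submanifold :: "'e::real_normed_vector set \<Rightarrow> ('e, 'e) manifold" where
  "open_submanifold S = \<lparr>mtop = top_of_set S, charts = {(S, id)}\<rparr>"

text \<open>The manifold whose topology is the one induced by the given charts.\<close>

definition manifold_of_charts ::
  "('a set \<times> ('a \<Rightarrow> 'e::topological_space)) set \<Rightarrow> ('a, 'e) manifold" where
  "manifold_of_charts A =
     \<lparr>mtop = topology_generated_by {{x\<in>U. c x \<in> W} | U c W. (U, c) \<in> A \<and> open W}, charts = A\<rparr>"


section \<open>Tangent spaces, differentials and the tangent bundle\<close>

text \<open>Tangent vectors at \<open>p\<close> are equivalence classes of smooth curves through \<open>p\<close>, defined near
  parameter \<open>0\<close>, two curves being equivalent if they have the same velocity in charts at \<open>p\<close>.\<close>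

type_synonym 'a tvec = "(real \<Rightarrow> 'a) set"

definition curves_at :: "('a, 'e::real_normed_vector) manifold \<Rightarrow> 'a \<Rightarrow> (real \<Rightarrow> 'a) set" where
  "curves_at M p = {\<gamma>. \<gamma> 0 = p \<and> (\<exists>\<epsilon>>0. smooth_map (open_submanifold {-\<epsilon><..<\<epsilon>}) M \<gamma>)}"

definition tangent_rel :: "('a, 'e::real_normed_vector) manifold \<Rightarrow> 'a \<Rightarrow> (real \<Rightarrow> 'a) rel" where
  "tangent_rel M p = {(\<gamma>, \<delta>). \<gamma> \<in> curves_at M p \<and> \<delta> \<in> curves_at M p \<and>
     (\<forall>(U, c)\<in>charts M. p \<in> U \<longrightarrow>
        vector_derivative (c \<circ> \<gamma>) (at 0) = vector_derivative (c \<circ> \<delta>) (at 0))}"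

definition tangent_space :: "('a, 'e::real_normed_vector) manifold \<Rightarrow> 'a \<Rightarrow> 'a tvec set" where
  "tangent_space M p = curves_at M p // tangent_rel M p"

text \<open>\<open>differential M N F p [\<gamma>] = [F \<circ> \<gamma>]\<close>; the union is over one and the same class.
  The class is formed in \<open>N\<close>, so the domain manifold does not occur as an argument.\<close>

definition differential ::
  "('b, 'f::real_normed_vector) manifold \<Rightarrow> ('a \<Rightarrow> 'b) \<Rightarrow> 'a \<Rightarrow> 'a tvec \<Rightarrow> 'b tvec" where
  "differential N F p v = (\<Union>\<gamma>\<in>v. tangent_rel N (F p) `` {F \<circ> \<gamma>})"

text \<open>The coordinates of a tangent vector in the chart \<open>c\<close>, the common velocity of its curves.\<close>

definition tangent_coord :: "('a \<Rightarrow> 'e::real_normed_vector) \<Rightarrow> 'a tvec \<Rightarrow> 'e" where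
  "tangent_coord c v = the_elem ((\<lambda>\<gamma>. vector_derivative (c \<circ> \<gamma>) (at 0)) ` v)"

text \<open>\<open>T\<^sub>pM\<close> with its smooth structure as a finite-dimensional vector space: the
  global charts are the coordinate isomorphisms given by the charts of \<open>M\<close> at \<open>p\<close>.\<close>

definition tangent_space_manifold ::
  "('a, 'e::real_normed_vector) manifold \<Rightarrow> 'a \<Rightarrow> ('a tvec, 'e) manifold" where
  "tangent_space_manifold M p =
     manifold_of_charts {(tangent_space M p, tangent_coord c) | U c. (U, c) \<in> charts M \<and> p \<in> U}"

definition tangent_bundle ::
  "('a, 'e::real_normed_vector) manifold \<Rightarrow> ('a \<times> 'a tvec, 'e \<times> 'e) manifold" where
  "tangent_bundle M =
     manifold_of_charts {(Sigma U (tangent_space M), \<lambda>(p, v). (c p, tangent_coord c v)) | U c.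
       (U, c) \<in> charts M}"

definition tangent_map ::
  "('b, 'f::real_normed_vector) manifold \<Rightarrow> ('a \<Rightarrow> 'b) \<Rightarrow> 'a \<times> 'a tvec \<Rightarrow> 'b \<times> 'b tvec" where
  "tangent_map N F = (\<lambda>(p, v). (F p, differential N F p v))"


section \<open>Embeddings and reduction maps\<close>

text \<open>Below, \<open>M\<close> is the full manifold, \<open>N\<close> the reduced manifold and \<open>\<phi>\<close> maps \<open>N\<close> to \<open>M\<close>.\<close>

definition smooth_immersion ::
  "('b, 'f::real_normed_vector) manifold \<Rightarrow> ('a, 'e::real_normed_vector) manifold \<Rightarrow> ('b \<Rightarrow> 'a) \<Rightarrow> bool"
  where
  "smooth_immersion N M \<phi> \<longleftrightarrow>
     smooth_map N M \<phi> \<and> (\<forall>p\<in>points N. inj_on (differential M \<phi> p) (tangent_space N p))"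

definition smooth_embedding ::
  "('b, 'f::real_normed_vector) manifold \<Rightarrow> ('a, 'e::real_normed_vector) manifold \<Rightarrow> ('b \<Rightarrow> 'a) \<Rightarrow> bool"
  where
  "smooth_embedding N M \<phi> \<longleftrightarrow> smooth_immersion N M \<phi> \<and> embedding_map (mtop N) (mtop M) \<phi>"

definition point_reduction ::
  "('a, 'e::real_normed_vector) manifold \<Rightarrow> ('b, 'f::real_normed_vector) manifold \<Rightarrow>
    ('b \<Rightarrow> 'a) \<Rightarrow> ('a \<Rightarrow> 'b) \<Rightarrow> bool" where
  "point_reduction M N \<phi> \<rho> \<longleftrightarrow> smooth_map M N \<rho> \<and> (\<forall>p\<in>points N. \<rho> (\<phi> p) = p)"

definition reduction_map ::
  "('a, 'e::real_normed_vector) manifold \<Rightarrow> ('b, 'f::real_normed_vector) manifold \<Rightarrow>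
    ('b \<Rightarrow> 'a) \<Rightarrow> ('a \<times> 'a tvec \<Rightarrow> 'b \<times> 'b tvec) \<Rightarrow> bool" where
  "reduction_map M N \<phi> R \<longleftrightarrow>
     smooth_map (tangent_bundle M) (tangent_bundle N) R \<and>
     (\<exists>\<rho> r. smooth_map M N \<rho> \<and>
        (\<forall>m\<in>points M.
           smooth_map (tangent_space_manifold M m) (tangent_space_manifold N (\<rho> m)) (r m) \<and>
           (\<forall>v\<in>tangent_space M m. R (m, v) = (\<rho> m, r m v)))) \<and>
     (\<forall>x\<in>points (tangent_bundle N). R (tangent_map M \<phi> x) = x)"

definition R_MPG ::
  "('b, 'f::real_normed_vector) manifold \<Rightarrow> ('a \<Rightarrow> 'b) \<Rightarrow> 'a \<times> 'a tvec \<Rightarrow> 'b \<times> 'b tvec" where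
  "R_MPG N \<rho> = (\<lambda>(m, v). (\<rho> m, differential N \<rho> m v))"

end

theory Submission
  imports Defs
begin

text \<open>The differential is functorial: \<open>d\<rho> \<circ> d\<phi>\<close> is the differential of \<open>\<rho> \<circ> \<phi>\<close>, because both
  send the class of a curve \<open>\<gamma>\<close> to the class of \<open>\<rho> \<circ> \<phi> \<circ> \<gamma>\<close> (\<open>differential_compose\<close>). As \<open>\<rho> \<circ> \<phi>\<close>
  is the identity on the reduced manifold, its differential is the identity too
  (\<open>differential_identity\<close>), which is the projection property.

  What remains is that \<open>(m, v) \<mapsto> (\<rho> m, d\<rho> v)\<close> is smooth, on the tangent bundle and on each tangent
  space. In charts \<open>c\<close> and \<open>d\<close>, write \<open>f = d \<circ> \<rho> \<circ> c\<^sup>-\<^sup>1\<close>. The bundle map reads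
  \<open>(y, w) \<mapsto> (f y, Df(y) w)\<close>, and its restriction to one fibre reads \<open>w \<mapsto> Df(y) w\<close>, so the first is
  smooth because \<open>f\<close> is (\<open>smooth_on_derivative_pair\<close>) and the second because it is linear.

  Everything about tangent vectors rests on one formula, the chain rule for velocities in charts,
  \<open>velocity_compose\<close>: it shows that differentials are well defined on classes of curves, that a
  single chart decides when two curves have the same tangent vector, and what differentials are in
  coordinates. The chain rule for \<open>C\<^sup>k\<close> functions, \<open>Ck_on_compose\<close>, is where finite dimension enters:
  smoothness is defined by directional derivatives, so the derivative of a composition has to be
  written as a finite sum over a basis. The topologies of the tangent spaces and of the tangent bundle
  are generated by their charts, so continuity of maps between them follows from continuity of their
  coordinate expressions (\<open>smooth_map_manifold_of_charts\<close>).\<close>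


section \<open>Calculus of smooth functions\<close>

text \<open>Openness matters: the derivative at a point of \<open>S\<close> sees the values of the function on a
  neighbourhood of it.\<close>

lemma Ck_on_cong:
  assumes "open S" "\<And>x. x \<in> S \<Longrightarrow> f x = g x" "Ck_on k S f"
  shows "Ck_on k S g"
  using assms(2,3)
proof (induction k arbitrary: f g)
  case 0
  then show ?case using continuous_on_cong[of S S f g] by simp
next
  case (Suc k)
  have diff: "f differentiable (at x)" if "x \<in> S" for x
    using Suc.prems(2) that by simp
  have "g differentiable (at x)" if "x \<in> S" for x
    using diff[OF that] assms(1) that Suc.prems(1)
    by (metis differentiable_def has_derivative_transform_within_open)
  moreover have "Ck_on k S (\<lambda>x. frechet_derivative g (at x) v)" for v
  proof (rule Suc.IH)
    show "Ck_on k S (\<lambda>x. frechet_derivative f (at x) v)" using Suc.prems(2) by simp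
    show "frechet_derivative f (at x) v = frechet_derivative g (at x) v" if "x \<in> S" for x
      using frechet_derivative_transform_within_open[OF diff[OF that] assms(1) that Suc.prems(1)]
      by simp
  qed
  ultimately show ?case by simp
qed

text \<open>Reduces \<open>C\<^sup>k\<^sup>+\<^sup>1\<close> to a derivative found by any means, without identifying it with
  \<^const>\<open>frechet_derivative\<close> each time.\<close>

lemma Ck_on_derivative:
  assumes "open S" "\<And>x. x \<in> S \<Longrightarrow> (f has_derivative f' x) (at x)"
    and "\<And>v. Ck_on k S (\<lambda>x. f' x v)"
  shows "Ck_on (Suc k) S f"
proof -
  have "Ck_on k S (\<lambda>x. frechet_derivative f (at x) v)" for v
    by (rule Ck_on_cong[OF assms(1) _ assms(3)[of v]]) (metis assms(2) frechet_derivative_at)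
  then show ?thesis using assms(2) by (auto simp: differentiable_def)
qed

lemma Ck_on_has_derivative:
  assumes "Ck_on (Suc k) S f" "x \<in> S"
  shows "(f has_derivative frechet_derivative f (at x)) (at x)"
  using assms frechet_derivative_works by auto

lemma Ck_on_subset: "Ck_on k S f \<Longrightarrow> T \<subseteq> S \<Longrightarrow> Ck_on k T f"
  by (induction k arbitrary: f) (auto intro: continuous_on_subset)

lemma Ck_on_lower: "Ck_on (Suc k) S f \<Longrightarrow> Ck_on k S f"
proof (induction k arbitrary: f)
  case 0
  then show ?case
    by (auto intro!: continuous_at_imp_continuous_on differentiable_imp_continuous_within)
next
  case (Suc k)
  have "Ck_on k S (\<lambda>x. frechet_derivative f (at x) v)" for v
    by (rule Suc.IH) (use Suc.prems in \<open>simp del: Ck_on.simps add: Ck_on.simps(2)[of "Suc k"]\<close>)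
  then show ?case using Suc.prems by simp
qed

lemma Ck_on_local:
  assumes "\<And>x. x \<in> S \<Longrightarrow> \<exists>T. open T \<and> x \<in> T \<and> Ck_on k T f"
  shows "Ck_on k S f"
  using assms
proof (induction k arbitrary: f)
  case 0
  then have "isCont f x" if "x \<in> S" for x
    using that continuous_on_eq_continuous_at by fastforce
  then show ?case by (simp add: continuous_at_imp_continuous_on)
next
  case (Suc k)
  have "Ck_on k S (\<lambda>x. frechet_derivative f (at x) v)" for v
    by (rule Suc.IH) (use Suc.prems in fastforce)
  moreover have "\<forall>x\<in>S. f differentiable (at x)" using Suc.prems by fastforce
  ultimately show ?case by simp
qed

lemma Ck_on_const: "Ck_on k S (\<lambda>x. a)"
  by (induction k arbitrary: a) simp_all

lemma Ck_on_bounded_linear_compose: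
  assumes "bounded_linear h" "open S" "Ck_on k S f"
  shows "Ck_on k S (\<lambda>x. h (f x))"
  using assms(3)
proof (induction k arbitrary: f)
  case 0
  then show ?case by (simp add: bounded_linear.continuous_on[OF assms(1)])
next
  case (Suc k)
  show ?case
  proof (rule Ck_on_derivative[OF assms(2)])
    show "((\<lambda>x. h (f x)) has_derivative (\<lambda>v. h (frechet_derivative f (at x) v))) (at x)"
      if "x \<in> S" for x
      using bounded_linear.has_derivative[OF assms(1) Ck_on_has_derivative[OF Suc.prems that]] .
    show "Ck_on k S (\<lambda>x. h (frechet_derivative f (at x) v))" for v
      using Suc by simp
  qed
qed

lemma Ck_on_bounded_linear:
  assumes "bounded_linear h" "open S"
  shows "Ck_on k S h"
proof (cases k)
  case 0
  then show ?thesis using assms(1) by (simp add: linear_continuous_on)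
next
  case (Suc j)
  show ?thesis unfolding Suc
    by (rule Ck_on_derivative[OF assms(2) bounded_linear_imp_has_derivative[OF assms(1)]])
      (rule Ck_on_const)
qed

lemma Ck_on_add:
  assumes "open S" "Ck_on k S f" "Ck_on k S g"
  shows "Ck_on k S (\<lambda>x. f x + g x)"
  using assms(2,3)
proof (induction k arbitrary: f g)
  case 0
  then show ?case by (simp add: continuous_on_add)
next
  case (Suc k)
  show ?case
  proof (rule Ck_on_derivative[OF assms(1)])
    show "((\<lambda>x. f x + g x) has_derivative
        (\<lambda>v. frechet_derivative f (at x) v + frechet_derivative g (at x) v)) (at x)" if "x \<in> S" for x
      by (intro has_derivative_add Ck_on_has_derivative[OF _ that]) (rule Suc.prems)+
  qed (use Suc in simp)
qed

lemma Ck_on_sum: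
  assumes "open S" "\<And>b. b \<in> B \<Longrightarrow> Ck_on k S (f b)"
  shows "Ck_on k S (\<lambda>x. \<Sum>b\<in>B. f b x)"
  using assms(2)
  by (induction B rule: infinite_finite_induct)
    (auto intro: Ck_on_const Ck_on_add[OF assms(1)])

lemma Ck_on_scaleR:
  assumes "open S" "Ck_on k S f" "Ck_on k S g"
  shows "Ck_on k S (\<lambda>x. f x *\<^sub>R g x)"
  using assms(2,3)
proof (induction k arbitrary: f g)
  case 0
  then show ?case by (simp add: continuous_on_scaleR)
next
  case (Suc k)
  show ?case
  proof (rule Ck_on_derivative[OF assms(1)])
    show "((\<lambda>x. f x *\<^sub>R g x) has_derivative
        (\<lambda>v. f x *\<^sub>R frechet_derivative g (at x) v + frechet_derivative f (at x) v *\<^sub>R g x)) (at x)"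
      if "x \<in> S" for x
      by (intro has_derivative_scaleR Ck_on_has_derivative[OF _ that]) (rule Suc.prems)+
    show "Ck_on k S
        (\<lambda>x. f x *\<^sub>R frechet_derivative g (at x) v + frechet_derivative f (at x) v *\<^sub>R g x)" for v
      by (intro Ck_on_add Suc.IH assms(1) Suc.prems[THEN Ck_on_lower]) (use Suc.prems in simp_all)
  qed
qed

lemma Ck_on_Pair:
  assumes "open S" "Ck_on k S f" "Ck_on k S g"
  shows "Ck_on k S (\<lambda>x. (f x, g x))"
  using assms(2,3)
proof (induction k arbitrary: f g)
  case 0
  then show ?case by (simp add: continuous_on_Pair)
next
  case (Suc k)
  show ?case
  proof (rule Ck_on_derivative[OF assms(1)])
    show "((\<lambda>x. (f x, g x)) has_derivative
        (\<lambda>v. (frechet_derivative f (at x) v, frechet_derivative g (at x) v))) (at x)" if "x \<in> S" for x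
      by (intro has_derivative_Pair Ck_on_has_derivative[OF _ that]) (rule Suc.prems)+
  qed (use Suc in simp)
qed

definition orthonormal_basis :: "'e::finite_dim_inner set" where
  "orthonormal_basis = (SOME B. finite B \<and>
     (\<forall>u\<in>B. \<forall>v\<in>B. inner u v = (if u = v then 1 else 0)) \<and>
     (\<forall>x. (\<forall>u\<in>B. inner x u = 0) \<longleftrightarrow> x = 0))"

lemma orthonormal_expansion:
  "(\<Sum>b\<in>orthonormal_basis. inner x b *\<^sub>R b) = (x :: 'e::finite_dim_inner)"
proof -
  let ?B = "orthonormal_basis :: 'e set"
  have B: "finite ?B" "\<And>u v. u \<in> ?B \<Longrightarrow> v \<in> ?B \<Longrightarrow> inner u v = (if u = v then 1 else 0)"
    "\<And>x. (\<forall>u\<in>?B. inner x u = 0) \<longleftrightarrow> x = 0"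
    using someI_ex[OF finite_orthonormal_basis[where 'a = 'e]]
    unfolding orthonormal_basis_def by blast+
  have "inner ((\<Sum>b\<in>?B. inner x b *\<^sub>R b) - x) u = 0" if "u \<in> ?B" for u
  proof -
    have "inner (\<Sum>b\<in>?B. inner x b *\<^sub>R b) u = (\<Sum>b\<in>?B. if b = u then inner x u else 0)"
      unfolding inner_sum_left by (rule sum.cong) (use B(2) that in auto)
    then show ?thesis using that B(1) by (simp add: inner_diff_left)
  qed
  then show ?thesis
    using B(3)[of "(\<Sum>b\<in>?B. inner x b *\<^sub>R b) - x"] by simp
qed

text \<open>Turns application of a derivative into a sum of products of scalar functions with the
  derivatives along fixed directions, the only ones that \<^const>\<open>Ck_on\<close> speaks of.\<close>

lemma linear_expansion:
  assumes "linear h"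
  shows "h (x :: 'e::finite_dim_inner) = (\<Sum>b\<in>orthonormal_basis. inner x b *\<^sub>R h b)"
  using arg_cong[OF orthonormal_expansion[of x], of h]
  by (simp add: linear_sum[OF assms] linear_scale[OF assms])

text \<open>By the chain rule, \<open>D(g \<circ> f)(x) v\<close> is the sum over an orthonormal basis of
  \<open>\<langle>Df(x) v, b\<rangle> Dg(f x) b\<close>. The factors \<open>Dg(f x) b\<close> are themselves compositions, of a \<open>C\<^sup>k\<close> function
  with \<open>f\<close>, which is why the induction generalises over \<open>g\<close>.\<close>

lemma Ck_on_compose:
  fixes f :: "'d::real_normed_vector \<Rightarrow> 'e::finite_dim_inner"
  assumes "open S" "open T" "f ` S \<subseteq> T" "Ck_on k S f" "Ck_on k T g"
  shows "Ck_on k S (g \<circ> f)"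
  using assms(4,5)
proof (induction k arbitrary: g)
  case 0
  then show ?case
    using assms(3) by (auto simp: comp_def intro: continuous_on_compose2)
next
  case (Suc k)
  let ?D = "\<lambda>x v. \<Sum>b\<in>orthonormal_basis.
    inner (frechet_derivative f (at x) v) b *\<^sub>R frechet_derivative g (at (f x)) b"
  show ?case
  proof (rule Ck_on_derivative[OF assms(1)])
    fix x assume x: "x \<in> S"
    have g: "(g has_derivative frechet_derivative g (at (f x))) (at (f x))"
      using Ck_on_has_derivative[OF Suc.prems(2)] x assms(3) by blast
    have "?D x = frechet_derivative g (at (f x)) \<circ> frechet_derivative f (at x)"
      unfolding fun_eq_iff o_apply
      by (intro allI linear_expansion[OF has_derivative_linear[OF g], symmetric])
    then show "(g \<circ> f has_derivative ?D x) (at x)"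
      using diff_chain_at[OF Ck_on_has_derivative[OF Suc.prems(1) x] g] by simp
  next
    fix v
    have "Ck_on k S (\<lambda>x. inner (frechet_derivative f (at x) v) b)" for b
      using Suc.prems(1)
      by (intro Ck_on_bounded_linear_compose[OF bounded_linear_inner_left assms(1)]) simp
    moreover have "Ck_on k S (\<lambda>x. frechet_derivative g (at (f x)) b)" for b
      using Suc.IH[OF Ck_on_lower[OF Suc.prems(1)], of "\<lambda>y. frechet_derivative g (at y) b"]
        Suc.prems(2) by (simp add: comp_def)
    ultimately show "Ck_on k S (\<lambda>x. ?D x v)"
      by (intro Ck_on_sum Ck_on_scaleR assms(1))
  qed
qed

lemma smooth_on_cong:
  "open S \<Longrightarrow> (\<And>x. x \<in> S \<Longrightarrow> f x = g x) \<Longrightarrow> smooth_on S f \<Longrightarrow> smooth_on S g"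
  unfolding smooth_on_def using Ck_on_cong by blast

lemma smooth_on_subset: "smooth_on S f \<Longrightarrow> T \<subseteq> S \<Longrightarrow> smooth_on T f"
  unfolding smooth_on_def using Ck_on_subset by blast

lemma smooth_on_local:
  assumes "\<And>x. x \<in> S \<Longrightarrow> \<exists>T. open T \<and> x \<in> T \<and> smooth_on T f"
  shows "smooth_on S f"
  unfolding smooth_on_def using assms by (metis Ck_on_local smooth_on_def)

lemma smooth_on_bounded_linear: "bounded_linear h \<Longrightarrow> open S \<Longrightarrow> smooth_on S h"
  by (simp add: smooth_on_def Ck_on_bounded_linear)

lemma smooth_on_line: "open S \<Longrightarrow> smooth_on S (\<lambda>t. a + t *\<^sub>R w)"
  unfolding smooth_on_def
  by (intro allI Ck_on_add Ck_on_const Ck_on_bounded_linear bounded_linear_scaleR_left)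

lemma smooth_on_Pair:
  "open S \<Longrightarrow> smooth_on S f \<Longrightarrow> smooth_on S g \<Longrightarrow> smooth_on S (\<lambda>x. (f x, g x))"
  by (simp add: smooth_on_def Ck_on_Pair)

lemma smooth_on_compose:
  fixes f :: "'d::real_normed_vector \<Rightarrow> 'e::finite_dim_inner"
  assumes "open S" "open T" "f ` S \<subseteq> T" "smooth_on S f" "smooth_on T g"
  shows "smooth_on S (g \<circ> f)"
  using assms(4,5) unfolding smooth_on_def by (blast intro: Ck_on_compose[OF assms(1-3)])

lemma smooth_on_continuous: "smooth_on S f \<Longrightarrow> continuous_on S f"
  unfolding smooth_on_def using Ck_on.simps(1) by blast

lemma smooth_on_has_derivative:
  "smooth_on S f \<Longrightarrow> x \<in> S \<Longrightarrow> (f has_derivative frechet_derivative f (at x)) (at x)"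
  unfolding smooth_on_def using Ck_on_has_derivative by blast

text \<open>This is the tangent map of \<open>f\<close> on the trivial bundle. It is smooth in both variables jointly,
  since \<open>Df(x) w\<close> is the sum of \<open>\<langle>w, b\<rangle> Df(x) b\<close> over an orthonormal basis.\<close>

lemma smooth_on_derivative_pair:
  fixes f :: "'e::finite_dim_inner \<Rightarrow> 'f::real_normed_vector"
  assumes S: "open S" and f: "smooth_on S f"
  shows "smooth_on (S \<times> UNIV) (\<lambda>(x, w). (f x, frechet_derivative f (at x) w))"
proof -
  have SU: "open (S \<times> (UNIV :: 'e set))" by (simp add: S open_Times)
  have along_fst: "smooth_on (S \<times> (UNIV :: 'e set)) (\<lambda>z. g (fst z))"
    if "smooth_on S g" for g :: "'e \<Rightarrow> 'f"
    using smooth_on_compose[OF SU S _ smooth_on_bounded_linear[OF bounded_linear_fst SU] that]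
    by (auto simp: comp_def)
  let ?D = "\<lambda>z. \<Sum>b\<in>orthonormal_basis. inner (snd z) b *\<^sub>R frechet_derivative f (at (fst z)) b"
  have "Ck_on k (S \<times> UNIV) ?D" for k
  proof (intro Ck_on_sum Ck_on_scaleR SU)
    fix b :: 'e
    show "Ck_on k (S \<times> UNIV) (\<lambda>z. inner (snd z) b)"
      by (intro Ck_on_bounded_linear SU bounded_linear_compose[OF bounded_linear_inner_left]
          bounded_linear_snd)
    have "smooth_on S (\<lambda>x. frechet_derivative f (at x) b)"
      using f unfolding smooth_on_def by (metis Ck_on.simps(2))
    from along_fst[OF this] show "Ck_on k (S \<times> (UNIV :: 'e set)) (\<lambda>z. frechet_derivative f (at (fst z)) b)"
      unfolding smooth_on_def by blast
  qed
  then have "smooth_on (S \<times> UNIV) (\<lambda>z. (f (fst z), ?D z))"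
    by (intro smooth_on_Pair[OF SU along_fst[OF f]]) (simp add: smooth_on_def)
  then show ?thesis
  proof (rule smooth_on_cong[OF SU, rotated])
    fix z :: "'e \<times> 'e" assume "z \<in> S \<times> UNIV"
    then have "linear (frechet_derivative f (at (fst z)))"
      using has_derivative_linear[OF smooth_on_has_derivative[OF f]] by auto
    then show "(f (fst z), ?D z) = (case z of (x, w) \<Rightarrow> (f x, frechet_derivative f (at x) w))"
      unfolding case_prod_beta by (simp only: linear_expansion[symmetric])
  qed
qed

section \<open>Charts and smooth maps\<close>

lemma chart_openin: "smooth_manifold M \<Longrightarrow> (U, c) \<in> charts M \<Longrightarrow> openin (mtop M) U"
  unfolding smooth_manifold_def by blast

lemma chart_homeomorphic:
  "smooth_manifold M \<Longrightarrow> (U, c) \<in> charts M \<Longrightarrow>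
     open (c ` U) \<and> homeomorphic_map (subtopology (mtop M) U) (top_of_set (c ` U)) c"
  unfolding smooth_manifold_def by blast

lemma chart_at:
  assumes "smooth_manifold M" "p \<in> points M"
  obtains U c where "(U, c) \<in> charts M" "p \<in> U"
  using assms unfolding smooth_manifold_def by blast

lemma chart_subset_points: "smooth_manifold M \<Longrightarrow> (U, c) \<in> charts M \<Longrightarrow> U \<subseteq> points M"
  using chart_openin openin_subset by blast

lemma chart_inj_on:
  assumes "smooth_manifold M" "(U, c) \<in> charts M"
  shows "inj_on c U"
  using homeomorphic_imp_injective_map chart_homeomorphic[OF assms] chart_subset_points[OF assms]
  by (fastforce simp: inf_absorb2)

lemma chart_open_image:
  assumes "smooth_manifold M" "(U, c) \<in> charts M" "openin (mtop M) W" "W \<subseteq> U"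
  shows "open (c ` W)"
proof -
  have "openin (top_of_set (c ` U)) (c ` W)"
    using homeomorphic_imp_open_map[of "subtopology (mtop M) U" "top_of_set (c ` U)" c]
      chart_homeomorphic[OF assms(1,2)] assms(3,4)
    by (simp add: open_map_def openin_open_subtopology chart_openin[OF assms(1,2)])
  then show ?thesis using chart_homeomorphic[OF assms(1,2)] openin_open_eq by blast
qed

lemma chart_inv_continuous:
  assumes M: "smooth_manifold M" and c: "(U, c) \<in> charts M"
  shows "continuous_map (top_of_set (c ` U)) (mtop M) (inv_into U c)"
proof -
  note inj = chart_inj_on[OF M c]
  have "openin (top_of_set (c ` U)) {y \<in> c ` U. inv_into U c y \<in> W}" if "openin (mtop M) W" for W
  proof -
    have "{y \<in> c ` U. inv_into U c y \<in> W} = c ` (U \<inter> W)" using inj by auto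
    moreover have "open (c ` (U \<inter> W))"
      using chart_open_image[OF M c] chart_openin[OF M c] that by blast
    ultimately show ?thesis by (metis Collect_restrict open_subset)
  qed
  moreover have "inv_into U c ` (c ` U) \<subseteq> points M"
    using inj chart_subset_points[OF M c] by auto
  ultimately show ?thesis by (auto simp: continuous_map)
qed

abbreviation local_rep :: "'a set \<Rightarrow> ('a \<Rightarrow> 'e) \<Rightarrow> ('b \<Rightarrow> 'f) \<Rightarrow> ('a \<Rightarrow> 'b) \<Rightarrow> 'e \<Rightarrow> 'f" where
  "local_rep U c d F \<equiv> d \<circ> F \<circ> inv_into U c"

lemma smooth_map_local_rep:
  "smooth_map M N F \<Longrightarrow> (U, c) \<in> charts M \<Longrightarrow> (V, d) \<in> charts N \<Longrightarrow>
     smooth_on (c ` {x\<in>U. F x \<in> V}) (local_rep U c d F)"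
  unfolding smooth_map_def by blast

lemma smooth_map_continuous: "smooth_map M N F \<Longrightarrow> continuous_map (mtop M) (mtop N) F"
  unfolding smooth_map_def by blast

lemma smooth_map_points: "smooth_map M N F \<Longrightarrow> p \<in> points M \<Longrightarrow> F p \<in> points N"
  using smooth_map_continuous continuous_map_image_subset_topspace by fastforce

lemma open_chart_preimage:
  assumes M: "smooth_manifold M" and c: "(U, c) \<in> charts M"
    and "continuous_map (mtop M) X F" "openin X V"
  shows "open (c ` {x\<in>U. F x \<in> V})"
proof -
  have "{x\<in>U. F x \<in> V} = U \<inter> {x \<in> points M. F x \<in> V}"
    using chart_subset_points[OF M c] by auto
  then show ?thesis
    using openin_continuous_map_preimage[OF assms(3,4)] chart_openin[OF M c]
    by (intro chart_open_image[OF M c]) auto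
qed

lemma smooth_map_id: "smooth_manifold M \<Longrightarrow> smooth_map M M id"
  unfolding smooth_map_def smooth_manifold_def by (auto simp: Int_def)

text \<open>Near a point, \<open>e \<circ> G \<circ> F \<circ> c\<^sup>-\<^sup>1\<close> factors through any chart of the middle manifold around
  the image point, and smoothness is a local property.\<close>

lemma smooth_map_compose:
  fixes N :: "('b, 'f::finite_dim_inner) manifold"
  assumes M: "smooth_manifold M" and N: "smooth_manifold N" and P: "smooth_manifold P"
    and F: "smooth_map M N F" and G: "smooth_map N P G"
  shows "smooth_map M P (G \<circ> F)"
proof -
  have contF: "continuous_map (mtop M) (mtop N) F" and contG: "continuous_map (mtop N) (mtop P) G"
    using F G by (auto intro: smooth_map_continuous)
  have contGF: "continuous_map (mtop M) (mtop P) (G \<circ> F)"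
    using continuous_map_compose[OF contF contG] .
  moreover have "smooth_on (c ` {x\<in>U. (G \<circ> F) x \<in> W}) (local_rep U c e (G \<circ> F))"
    if c: "(U, c) \<in> charts M" and e: "(W, e) \<in> charts P" for U c W e
  proof (rule smooth_on_local)
    fix y assume "y \<in> c ` {x\<in>U. (G \<circ> F) x \<in> W}"
    then obtain x where x: "x \<in> U" "G (F x) \<in> W" "y = c x" by auto
    then have "F x \<in> points N"
      using smooth_map_points[OF F] chart_subset_points[OF M c] by blast
    then obtain V d where d: "(V, d) \<in> charts N" and Fx: "F x \<in> V"
      using chart_at[OF N] by blast
    let ?T = "c ` {x\<in>U. F x \<in> V \<and> G (F x) \<in> W}" and ?T' = "d ` {z\<in>V. G z \<in> W}"
    have "{z\<in>V. G z \<in> W} = V \<inter> {z\<in>points N. G z \<in> W}"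
      using chart_subset_points[OF N d] by auto
    then have "openin (mtop N) {z\<in>V. G z \<in> W}"
      using openin_continuous_map_preimage[OF contG chart_openin[OF P e]] chart_openin[OF N d]
      by auto
    from open_chart_preimage[OF M c contF this] have T: "open ?T" by simp
    have T': "open ?T'" by (rule open_chart_preimage[OF N d contG chart_openin[OF P e]])
    have inv_c: "inv_into U c (c x) = x" if "x \<in> U" for x
      using that chart_inj_on[OF M c] by simp
    have inv_d: "inv_into V d (d z) = z" if "z \<in> V" for z
      using that chart_inj_on[OF N d] by simp
    have "smooth_on ?T (local_rep V d e G \<circ> local_rep U c d F)"
    proof (rule smooth_on_compose[OF T T'])
      show "local_rep U c d F ` ?T \<subseteq> ?T'" using inv_c by auto
      show "smooth_on ?T (local_rep U c d F)"
        by (rule smooth_on_subset[OF smooth_map_local_rep[OF F c d]]) auto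
      show "smooth_on ?T' (local_rep V d e G)" by (rule smooth_map_local_rep[OF G d e])
    qed
    then have "smooth_on ?T (local_rep U c e (G \<circ> F))"
      by (rule smooth_on_cong[OF T, rotated]) (auto simp: inv_c inv_d)
    then show "\<exists>T. open T \<and> y \<in> T \<and> smooth_on T (local_rep U c e (G \<circ> F))"
      using T x Fx by blast
  qed
  ultimately show ?thesis unfolding smooth_map_def by blast
qed

text \<open>Makes a curve an ordinary smooth map between manifolds, so that results on smooth maps apply to
  its parameter interval.\<close>

lemma smooth_manifold_open_submanifold:
  fixes S :: "'e::euclidean_space set"
  assumes "open S"
  shows "smooth_manifold (open_submanifold S)"
proof -
  have "second_countable (euclidean :: 'e topology)"
  proof -
    obtain \<B> :: "'e set set" where \<B>: "countable \<B>" "\<And>C. C \<in> \<B> \<Longrightarrow> open C"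
      "\<And>S. open S \<Longrightarrow> \<exists>U. U \<subseteq> \<B> \<and> S = \<Union>U"
      using univ_second_countable by blast
    have "\<exists>V\<in>\<B>. x \<in> V \<and> V \<subseteq> U" if "open U" "x \<in> U" for U x
      using \<B>(3)[OF that(1)] that(2) by blast
    then show ?thesis unfolding second_countable_def using \<B>(1,2) by auto
  qed
  moreover have "smooth_on S (id \<circ> inv_into S id)"
    by (rule smooth_on_cong[OF assms _ smooth_on_bounded_linear[OF bounded_linear_ident assms]])
      (metis comp_apply id_apply inj_on_id inv_into_f_f)
  ultimately show ?thesis
    using assms unfolding smooth_manifold_def open_submanifold_def
    by (simp add: Hausdorff_space_subtopology second_countable_subtopology subtopology_subtopology
        homeomorphic_map_id)
qed


section \<open>Curves and their velocities\<close>

abbreviation velocity :: "('a \<Rightarrow> 'e::real_normed_vector) \<Rightarrow> (real \<Rightarrow> 'a) \<Rightarrow> 'e" where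
  "velocity c \<gamma> \<equiv> vector_derivative (c \<circ> \<gamma>) (at 0)"

lemma curves_atD:
  assumes "\<gamma> \<in> curves_at M p"
  shows "\<gamma> 0 = p" and "\<exists>\<epsilon>>0. smooth_map (open_submanifold {-\<epsilon><..<\<epsilon>}) M \<gamma>"
  using assms unfolding curves_at_def by auto

lemma curves_at_in_points:
  assumes "\<gamma> \<in> curves_at M p"
  shows "p \<in> points M"
proof -
  obtain \<epsilon> where "\<epsilon> > 0" "smooth_map (open_submanifold {-\<epsilon><..<\<epsilon>}) M \<gamma>"
    using curves_atD(2)[OF assms] by blast
  then show ?thesis
    using smooth_map_points[of "open_submanifold {-\<epsilon><..<\<epsilon>}" M \<gamma> 0] curves_atD(1)[OF assms]
    by (simp add: open_submanifold_def)
qed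

lemma curves_at_compose:
  fixes M :: "('a, 'e::finite_dim_inner) manifold"
  assumes "smooth_manifold M" "smooth_manifold N" "smooth_map M N F" "\<gamma> \<in> curves_at M p"
  shows "F \<circ> \<gamma> \<in> curves_at N (F p)"
proof -
  obtain \<epsilon> where \<epsilon>: "\<epsilon> > 0" "smooth_map (open_submanifold {-\<epsilon><..<\<epsilon>}) M \<gamma>"
    using curves_atD(2)[OF assms(4)] by blast
  have "smooth_map (open_submanifold {-\<epsilon><..<\<epsilon>}) N (F \<circ> \<gamma>)"
    by (rule smooth_map_compose[OF smooth_manifold_open_submanifold assms(1,2) \<epsilon>(2) assms(3)]) simp
  then show ?thesis using \<epsilon>(1) curves_atD(1)[OF assms(4)] unfolding curves_at_def by auto
qed

lemma curve_in_chart: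
  assumes M: "smooth_manifold M" and c: "(U, c) \<in> charts M"
    and \<gamma>: "\<gamma> \<in> curves_at M p" and "p \<in> U"
  shows "\<exists>J. open J \<and> 0 \<in> J \<and> \<gamma> ` J \<subseteq> U \<and> smooth_on J (c \<circ> \<gamma>)"
proof -
  obtain \<epsilon> where \<epsilon>: "\<epsilon> > 0" "smooth_map (open_submanifold {-\<epsilon><..<\<epsilon>}) M \<gamma>"
    using curves_atD(2)[OF \<gamma>] by blast
  let ?I = "{-\<epsilon><..<\<epsilon>}"
  let ?J = "id ` {t \<in> ?I. \<gamma> t \<in> U}"
  have I: "(?I, id) \<in> charts (open_submanifold ?I)" by (simp add: open_submanifold_def)
  have J: "open ?J"
    by (rule open_chart_preimage[OF smooth_manifold_open_submanifold I
          smooth_map_continuous[OF \<epsilon>(2)] chart_openin[OF M c]]) simp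
  have "smooth_on ?J (local_rep ?I id c \<gamma>)" by (rule smooth_map_local_rep[OF \<epsilon>(2) I c])
  moreover have "inv_into ?I id t = t" if "t \<in> ?J" for t
    using inv_into_f_f[of id ?I t] that by simp
  ultimately have "smooth_on ?J (c \<circ> \<gamma>)" by (elim smooth_on_cong[OF J, rotated]) simp
  then show ?thesis
    using J \<epsilon>(1) assms(4) curves_atD(1)[OF \<gamma>] by (intro exI[of _ ?J]) auto
qed

lemma curve_has_velocity:
  assumes "smooth_manifold M" "(U, c) \<in> charts M" "\<gamma> \<in> curves_at M p" "p \<in> U"
  shows "(c \<circ> \<gamma> has_vector_derivative velocity c \<gamma>) (at 0)"
  using curve_in_chart[OF assms] smooth_on_has_derivative vector_derivative_works
  unfolding differentiable_def by blast

text \<open>Near \<open>0\<close> the curve stays in the chart domain \<open>U\<close>, so there \<open>d \<circ> F \<circ> \<gamma>\<close> is the composition of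
  the coordinate expression of \<open>F\<close> with \<open>c \<circ> \<gamma>\<close>, and the chain rule applies.\<close>

lemma velocity_compose:
  fixes M :: "('a, 'e::finite_dim_inner) manifold"
  assumes M: "smooth_manifold M" and N: "smooth_manifold N" and F: "smooth_map M N F"
    and c: "(U, c) \<in> charts M" and d: "(V, d) \<in> charts N" and p: "p \<in> U" "F p \<in> V"
    and \<gamma>: "\<gamma> \<in> curves_at M p"
  shows "velocity d (F \<circ> \<gamma>) = frechet_derivative (local_rep U c d F) (at (c p)) (velocity c \<gamma>)"
proof -
  let ?f = "local_rep U c d F"
  have f: "(?f has_derivative frechet_derivative ?f (at (c p))) (at ((c \<circ> \<gamma>) 0))"
    using smooth_on_has_derivative[OF smooth_map_local_rep[OF F c d], of "c p"] p
    by (simp add: curves_atD(1)[OF \<gamma>])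
  obtain J where J: "open J" "0 \<in> J" "\<gamma> ` J \<subseteq> U"
    using curve_in_chart[OF M c \<gamma> p(1)] by blast
  have "(?f \<circ> (c \<circ> \<gamma>) has_vector_derivative
      frechet_derivative ?f (at (c p)) (velocity c \<gamma>)) (at 0)"
    by (rule vector_derivative_diff_chain_within[OF curve_has_velocity[OF M c \<gamma> p(1)]
          has_derivative_at_withinI[OF f]])
  then have "(d \<circ> (F \<circ> \<gamma>) has_vector_derivative
      frechet_derivative ?f (at (c p)) (velocity c \<gamma>)) (at 0)"
    by (rule has_vector_derivative_transform_within_open[OF _ J(1,2)])
      (use J(3) chart_inj_on[OF M c] in auto)
  then show ?thesis by (rule vector_derivative_at)
qed

text \<open>The curve is a straight line in the chart. It makes the coordinate map of a tangent space
  surjective.\<close>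

lemma ex_curve_with_velocity:
  fixes M :: "('a, 'e::finite_dim_inner) manifold"
  assumes M: "smooth_manifold M" and c: "(U, c) \<in> charts M" and p: "p \<in> U"
  shows "\<exists>\<gamma>\<in>curves_at M p. velocity c \<gamma> = w"
proof -
  let ?l = "\<lambda>t. c p + t *\<^sub>R w" and ?\<gamma> = "\<lambda>t. inv_into U c (c p + t *\<^sub>R w)"
  have inv_c: "inv_into U c (c x) = x" if "x \<in> U" for x
    using that chart_inj_on[OF M c] by simp
  have cont_l: "continuous_on UNIV ?l" by (intro continuous_intros)
  have "open (c ` U)" using chart_homeomorphic[OF M c] by blast
  then have "open (?l -` (c ` U))" using cont_l open_vimage by blast
  moreover have "0 \<in> ?l -` (c ` U)" using p by simp
  ultimately obtain \<epsilon> where \<epsilon>: "\<epsilon> > 0" "ball 0 \<epsilon> \<subseteq> ?l -` (c ` U)"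
    using open_contains_ball by metis
  let ?I = "{-\<epsilon><..<\<epsilon>}"
  have l: "?l t \<in> c ` U" if "t \<in> ?I" for t using \<epsilon>(2) that by (auto simp: subset_iff)
  have "continuous_map (top_of_set ?I) (top_of_set (c ` U)) ?l"
    using continuous_on_subset[OF cont_l] l by auto
  from continuous_map_compose[OF this chart_inv_continuous[OF M c]]
  have cont: "continuous_map (top_of_set ?I) (mtop M) ?\<gamma>" by (simp add: comp_def)
  have I: "(?I, id) \<in> charts (open_submanifold ?I)" by (simp add: open_submanifold_def)
  have "smooth_on (id ` {t\<in>?I. ?\<gamma> t \<in> V}) (local_rep ?I id d ?\<gamma>)"
    if d: "(V, d) \<in> charts M" for V d
  proof -
    have J: "open (id ` {t\<in>?I. ?\<gamma> t \<in> V})" (is "open ?J")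
      by (rule open_chart_preimage[OF smooth_manifold_open_submanifold I _ chart_openin[OF M d]])
        (use cont in \<open>simp_all add: open_submanifold_def\<close>)
    have T: "open (c ` {x\<in>U. id x \<in> V})" (is "open ?T")
      by (rule open_chart_preimage[OF M c _ chart_openin[OF M d]]) simp
    have "smooth_on ?J (local_rep U c d id \<circ> ?l)"
    proof (rule smooth_on_compose[OF J T _ smooth_on_line[OF J]
          smooth_map_local_rep[OF smooth_map_id[OF M] c d]])
      show "?l ` ?J \<subseteq> ?T" using l by (force simp: inv_c)
    qed
    moreover have "inv_into ?I id t = t" if "t \<in> ?J" for t
      using inv_into_f_f[of id ?I t] that by simp
    ultimately show ?thesis by (elim smooth_on_cong[OF J, rotated]) simp
  qed
  then have "smooth_map (open_submanifold ?I) M ?\<gamma>"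
    using cont unfolding smooth_map_def by (auto simp: open_submanifold_def)
  then have \<gamma>: "?\<gamma> \<in> curves_at M p"
    using \<epsilon>(1) p by (auto simp: curves_at_def inv_c)
  have "(?l has_vector_derivative w) (at 0)"
    by (auto intro!: derivative_eq_intros)
  moreover have "?l t = (c \<circ> ?\<gamma>) t" if "t \<in> ?I" for t
    using f_inv_into_f[OF l[OF that]] by simp
  ultimately have "(c \<circ> ?\<gamma> has_vector_derivative w) (at 0)"
    using \<epsilon>(1) has_vector_derivative_transform_within_open[of ?l w 0 ?I "c \<circ> ?\<gamma>"] by simp
  then show ?thesis using \<gamma> vector_derivative_at by blast
qed

section \<open>Tangent vectors and differentials\<close>

lemma equiv_tangent_rel: "equiv (curves_at M p) (tangent_rel M p)"
proof (rule equivI)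
  show "tangent_rel M p \<subseteq> curves_at M p \<times> curves_at M p" unfolding tangent_rel_def by blast
  show "refl_on (curves_at M p) (tangent_rel M p)" unfolding tangent_rel_def refl_on_def by auto
  show "sym (tangent_rel M p)" unfolding tangent_rel_def sym_def by (simp add: case_prod_beta)
  show "trans (tangent_rel M p)" unfolding tangent_rel_def trans_def by (simp add: case_prod_beta)
qed

text \<open>One chart suffices: by the chain rule for the identity map, the velocity in any other chart is
  the image of the velocity in \<open>c\<close> under the derivative of the transition map.\<close>

lemma tangent_rel_iff_velocity:
  fixes M :: "('a, 'e::finite_dim_inner) manifold"
  assumes M: "smooth_manifold M" and c: "(U, c) \<in> charts M" and p: "p \<in> U"
    and \<gamma>: "\<gamma> \<in> curves_at M p" and \<delta>: "\<delta> \<in> curves_at M p"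
  shows "(\<gamma>, \<delta>) \<in> tangent_rel M p \<longleftrightarrow> velocity c \<gamma> = velocity c \<delta>"
proof -
  have "velocity d \<eta> = frechet_derivative (local_rep U c d id) (at (c p)) (velocity c \<eta>)"
    if "(V, d) \<in> charts M" "p \<in> V" "\<eta> \<in> curves_at M p" for V d \<eta>
    using velocity_compose[OF M M smooth_map_id[OF M] c that(1) p _ that(3)] that(2) by simp
  then have "velocity d \<gamma> = velocity d \<delta>"
    if "velocity c \<gamma> = velocity c \<delta>" "(V, d) \<in> charts M" "p \<in> V" for V d
    using \<gamma> \<delta> that by metis
  then show ?thesis using c p \<gamma> \<delta> unfolding tangent_rel_def by blast
qed

abbreviation tangent_class :: "('a, 'e::real_normed_vector) manifold \<Rightarrow> 'a \<Rightarrow> (real \<Rightarrow> 'a) \<Rightarrow> 'a tvec"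
  where "tangent_class M p \<gamma> \<equiv> tangent_rel M p `` {\<gamma>}"

lemma tangent_classI: "\<gamma> \<in> curves_at M p \<Longrightarrow> tangent_class M p \<gamma> \<in> tangent_space M p"
  unfolding tangent_space_def by (rule quotientI)

lemma tangent_classE:
  assumes "v \<in> tangent_space M p"
  obtains \<gamma> where "\<gamma> \<in> curves_at M p" "v = tangent_class M p \<gamma>"
  using assms unfolding tangent_space_def by (rule quotientE)

lemma tangent_class_eq: "(\<gamma>, \<delta>) \<in> tangent_rel M p \<Longrightarrow> tangent_class M p \<gamma> = tangent_class M p \<delta>"
  by (rule equiv_class_eq[OF equiv_tangent_rel])

lemma tangent_class_self: "\<gamma> \<in> curves_at M p \<Longrightarrow> \<gamma> \<in> tangent_class M p \<gamma>"
  by (rule equiv_class_self[OF equiv_tangent_rel])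

lemma tangent_coord_class:
  assumes "(U, c) \<in> charts M" "p \<in> U" "\<gamma> \<in> curves_at M p"
  shows "tangent_coord c (tangent_class M p \<gamma>) = velocity c \<gamma>"
proof -
  have "velocity c ` tangent_class M p \<gamma> = {velocity c \<gamma>}"
    using tangent_class_self[OF assms(3)] assms(1,2) unfolding tangent_rel_def by fastforce
  then show ?thesis by (simp add: tangent_coord_def)
qed

lemma bij_betw_tangent_coord:
  fixes M :: "('a, 'e::finite_dim_inner) manifold"
  assumes M: "smooth_manifold M" and c: "(U, c) \<in> charts M" and p: "p \<in> U"
  shows "bij_betw (tangent_coord c) (tangent_space M p) UNIV"
proof (rule bij_betw_imageI)
  show "inj_on (tangent_coord c) (tangent_space M p)"
    by (rule inj_onI, elim tangent_classE)
      (simp add: tangent_coord_class[OF c p] tangent_rel_iff_velocity[OF M c p] tangent_class_eq)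
  have "w \<in> tangent_coord c ` tangent_space M p" for w
  proof -
    obtain \<gamma> where "\<gamma> \<in> curves_at M p" "velocity c \<gamma> = w"
      using ex_curve_with_velocity[OF M c p] by blast
    then show ?thesis
      using tangent_coord_class[OF c p] tangent_classI by (metis imageI)
  qed
  then show "tangent_coord c ` tangent_space M p = UNIV" by blast
qed

text \<open>The union that defines the differential ranges over classes that are all the same, since the
  velocity of \<open>F \<circ> \<delta>\<close> depends only on the velocity of \<open>\<delta>\<close>.\<close>

lemma differential_class:
  fixes M :: "('a, 'e::finite_dim_inner) manifold" and N :: "('b, 'f::finite_dim_inner) manifold"
  assumes M: "smooth_manifold M" and N: "smooth_manifold N" and F: "smooth_map M N F"
    and \<gamma>: "\<gamma> \<in> curves_at M p"
  shows "differential N F p (tangent_class M p \<gamma>) = tangent_class N (F p) (F \<circ> \<gamma>)"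
proof -
  have p: "p \<in> points M" using curves_at_in_points[OF \<gamma>] .
  obtain U c where c: "(U, c) \<in> charts M" "p \<in> U" using chart_at[OF M p] .
  obtain V d where d: "(V, d) \<in> charts N" "F p \<in> V"
    using chart_at[OF N smooth_map_points[OF F p]] .
  have "tangent_class N (F p) (F \<circ> \<delta>) = tangent_class N (F p) (F \<circ> \<gamma>)"
    if \<delta>: "\<delta> \<in> tangent_class M p \<gamma>" for \<delta>
  proof -
    have \<delta>_curve: "\<delta> \<in> curves_at M p" using \<delta> unfolding tangent_rel_def by auto
    have "velocity c \<delta> = velocity c \<gamma>" using \<delta> c unfolding tangent_rel_def by fastforce
    then have "velocity d (F \<circ> \<delta>) = velocity d (F \<circ> \<gamma>)"
      using velocity_compose[OF M N F c(1) d(1) c(2) d(2)] \<gamma> \<delta>_curve by simp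
    then show ?thesis
      using tangent_rel_iff_velocity[OF N d] curves_at_compose[OF M N F] \<gamma> \<delta>_curve
      by (intro tangent_class_eq) simp
  qed
  then show ?thesis
    unfolding differential_def using tangent_class_self[OF \<gamma>] by blast
qed

lemma differential_in_tangent_space:
  fixes M :: "('a, 'e::finite_dim_inner) manifold" and N :: "('b, 'f::finite_dim_inner) manifold"
  assumes M: "smooth_manifold M" and N: "smooth_manifold N" and F: "smooth_map M N F"
    and v: "v \<in> tangent_space M p"
  shows "differential N F p v \<in> tangent_space N (F p)"
proof -
  obtain \<gamma> where \<gamma>: "\<gamma> \<in> curves_at M p" "v = tangent_class M p \<gamma>" using tangent_classE[OF v] .
  then show ?thesis
    using differential_class[OF M N F] curves_at_compose[OF M N F] by (simp add: tangent_classI)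
qed

lemma tangent_coord_differential:
  fixes M :: "('a, 'e::finite_dim_inner) manifold" and N :: "('b, 'f::finite_dim_inner) manifold"
  assumes M: "smooth_manifold M" and N: "smooth_manifold N" and F: "smooth_map M N F"
    and c: "(U, c) \<in> charts M" "p \<in> U" and d: "(V, d) \<in> charts N" "F p \<in> V"
    and v: "v \<in> tangent_space M p"
  shows "tangent_coord d (differential N F p v) =
    frechet_derivative (local_rep U c d F) (at (c p)) (tangent_coord c v)"
proof -
  obtain \<gamma> where \<gamma>: "\<gamma> \<in> curves_at M p" "v = tangent_class M p \<gamma>" using tangent_classE[OF v] .
  then show ?thesis
    using velocity_compose[OF M N F c(1) d(1) c(2) d(2)]
    by (simp add: differential_class[OF M N F] tangent_coord_class[OF c] tangent_coord_class[OF d]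
        curves_at_compose[OF M N F])
qed

lemma differential_compose:
  fixes M :: "('a, 'e::finite_dim_inner) manifold" and N :: "('b, 'f::finite_dim_inner) manifold"
    and P :: "('c, 'g::finite_dim_inner) manifold"
  assumes M: "smooth_manifold M" and N: "smooth_manifold N" and P: "smooth_manifold P"
    and F: "smooth_map M N F" and G: "smooth_map N P G" and v: "v \<in> tangent_space M p"
  shows "differential P G (F p) (differential N F p v) = differential P (G \<circ> F) p v"
proof -
  obtain \<gamma> where \<gamma>: "\<gamma> \<in> curves_at M p" "v = tangent_class M p \<gamma>" using tangent_classE[OF v] .
  have "differential P G (F p) (differential N F p v) = tangent_class P (G (F p)) (G \<circ> (F \<circ> \<gamma>))"
    using \<gamma> by (simp add: differential_class[OF M N F] differential_class[OF N P G]
        curves_at_compose[OF M N F])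
  also have "\<dots> = differential P (G \<circ> F) p v"
    using \<gamma> differential_class[OF M P smooth_map_compose[OF M N P F G]] by (simp add: comp_assoc)
  finally show ?thesis .
qed

text \<open>A curve at \<open>p\<close> takes values in \<open>M\<close> for parameters near \<open>0\<close> only, so \<open>F \<circ> \<gamma>\<close> and \<open>\<gamma>\<close> can be
  different functions; but they agree near \<open>0\<close> and so have the same velocity.\<close>

lemma differential_identity:
  fixes M :: "('a, 'e::finite_dim_inner) manifold"
  assumes M: "smooth_manifold M" and F: "smooth_map M M F" and id: "\<And>q. q \<in> points M \<Longrightarrow> F q = q"
    and v: "v \<in> tangent_space M p"
  shows "differential M F p v = v"
proof -
  obtain \<gamma> where \<gamma>: "\<gamma> \<in> curves_at M p" "v = tangent_class M p \<gamma>" using tangent_classE[OF v] .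
  have p: "p \<in> points M" using curves_at_in_points[OF \<gamma>(1)] .
  then have F\<gamma>: "F \<circ> \<gamma> \<in> curves_at M p" using curves_at_compose[OF M M F \<gamma>(1)] id by simp
  obtain U c where c: "(U, c) \<in> charts M" "p \<in> U" using chart_at[OF M p] .
  obtain J where J: "open J" "0 \<in> J" "\<gamma> ` J \<subseteq> U" using curve_in_chart[OF M c(1) \<gamma>(1) c(2)] by blast
  have "(c \<circ> (F \<circ> \<gamma>) has_vector_derivative velocity c \<gamma>) (at 0)"
    by (rule has_vector_derivative_transform_within_open[OF
          curve_has_velocity[OF M c(1) \<gamma>(1) c(2)] J(1,2)])
      (use J(3) id chart_subset_points[OF M c(1)] in \<open>simp add: image_subset_iff subset_iff\<close>)
  then have "(F \<circ> \<gamma>, \<gamma>) \<in> tangent_rel M p"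
    using tangent_rel_iff_velocity[OF M c F\<gamma> \<gamma>(1)] vector_derivative_at by blast
  from tangent_class_eq[OF this] show ?thesis
    unfolding \<gamma>(2) differential_class[OF M M F \<gamma>(1)] id[OF p] .
qed


section \<open>Tangent maps are smooth\<close>

lemma charts_manifold_of_charts: "charts (manifold_of_charts A) = A"
  unfolding manifold_of_charts_def by simp

lemma openin_manifold_of_charts:
  assumes "(U, c) \<in> A" "open W"
  shows "openin (mtop (manifold_of_charts A)) {x\<in>U. c x \<in> W}"
  unfolding manifold_of_charts_def using assms
  by (auto intro!: topology_generated_by_Basis)

lemma topspace_manifold_of_charts: "points (manifold_of_charts A) = (\<Union>(U, c)\<in>A. U)"
proof
  show "points (manifold_of_charts A) \<subseteq> (\<Union>(U, c)\<in>A. U)"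
    by (auto simp: manifold_of_charts_def)
  have "U \<subseteq> points (manifold_of_charts A)" if "(U, c) \<in> A" for U c
    using openin_subset[OF openin_manifold_of_charts[OF that open_UNIV]] by simp
  then show "(\<Union>(U, c)\<in>A. U) \<subseteq> points (manifold_of_charts A)" by blast
qed

text \<open>Continuity comes for free: the preimage under \<open>F\<close> of a basic open set of the target is the
  union over the charts \<open>c\<close> of the source of the \<open>c\<close>-preimages of open sets, because the coordinate
  expressions are continuous on open sets.\<close>

lemma smooth_map_manifold_of_charts:
  assumes into: "\<And>U c x. (U, c) \<in> A \<Longrightarrow> x \<in> U \<Longrightarrow> \<exists>(V, d)\<in>B. F x \<in> V"
    and inj: "\<And>U c. (U, c) \<in> A \<Longrightarrow> inj_on c U"
    and op: "\<And>U c V d. (U, c) \<in> A \<Longrightarrow> (V, d) \<in> B \<Longrightarrow> open (c ` {x\<in>U. F x \<in> V})"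
    and smooth: "\<And>U c V d. (U, c) \<in> A \<Longrightarrow> (V, d) \<in> B \<Longrightarrow>
      smooth_on (c ` {x\<in>U. F x \<in> V}) (local_rep U c d F)"
  shows "smooth_map (manifold_of_charts A) (manifold_of_charts B) F"
proof -
  let ?X = "mtop (manifold_of_charts A)"
  let ?S = "{{x\<in>V. d x \<in> W} | V d W. (V, d) \<in> B \<and> open W}"
  have "openin ?X (F -` {y\<in>V. d y \<in> W} \<inter> topspace ?X)" if d: "(V, d) \<in> B" and W: "open W" for V d W
  proof -
    let ?W = "\<lambda>U c. c ` {x\<in>U. F x \<in> V} \<inter> local_rep U c d F -` W"
    have "open (?W U c)" if "(U, c) \<in> A" for U c
      by (rule continuous_open_preimage[OF smooth_on_continuous[OF smooth[OF that d]] op[OF that d] W])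
    then have "openin ?X (\<Union>(U, c)\<in>A. {x\<in>U. c x \<in> ?W U c})"
      by (intro openin_Union) (auto simp del: vimage_eq Int_iff intro!: openin_manifold_of_charts)
    moreover have "c x \<in> ?W U c \<longleftrightarrow> F x \<in> V \<and> d (F x) \<in> W"
      if c: "(U, c) \<in> A" and x: "x \<in> U" for U c x
    proof -
      have "c x \<in> c ` {x\<in>U. F x \<in> V} \<longleftrightarrow> F x \<in> V"
        using inj_on_image_mem_iff[OF inj[OF c] x, of "{x\<in>U. F x \<in> V}"] x by auto
      then show ?thesis by (simp add: inv_into_f_f[OF inj[OF c] x])
    qed
    then have "(\<Union>(U, c)\<in>A. {x\<in>U. c x \<in> ?W U c}) =
        (\<Union>(U, c)\<in>A. {x\<in>U. F x \<in> V \<and> d (F x) \<in> W})"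
      by (intro SUP_cong refl) (clarsimp simp del: Int_iff, blast)
    moreover have "\<dots> = F -` {y\<in>V. d y \<in> W} \<inter> topspace ?X"
      unfolding topspace_manifold_of_charts by blast
    ultimately show ?thesis by simp
  qed
  moreover have "F ` topspace ?X \<subseteq> points (manifold_of_charts B)"
    unfolding topspace_manifold_of_charts by clarify (use into in blast)
  then have "F ` topspace ?X \<subseteq> \<Union>?S" by (simp add: manifold_of_charts_def)
  ultimately have "continuous_map ?X (topology_generated_by ?S) F"
    unfolding continuous_on_generated_topo_iff by blast
  then have "continuous_map ?X (mtop (manifold_of_charts B)) F"
    by (simp add: manifold_of_charts_def)
  then show ?thesis
    using smooth unfolding smooth_map_def charts_manifold_of_charts by blast
qed

text \<open>In bundle charts the tangent map is \<open>(y, w) \<mapsto> (f y, Df(y) w)\<close> for the coordinate expression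
  \<open>f\<close> of \<open>F\<close>. It is defined on the product of the domain of \<open>f\<close> with the whole model space, since
  every vector is the coordinate of some tangent vector.\<close>

lemma smooth_map_tangent_map:
  fixes M :: "('a, 'e::finite_dim_inner) manifold" and N :: "('b, 'f::finite_dim_inner) manifold"
  assumes M: "smooth_manifold M" and N: "smooth_manifold N" and F: "smooth_map M N F"
  shows "smooth_map (tangent_bundle M) (tangent_bundle N) (tangent_map N F)"
proof -
  let ?TM = "tangent_space M" and ?TN = "tangent_space N"
  let ?chart = "\<lambda>c (p, v). (c p, tangent_coord c v)"
  have inj: "inj_on (?chart c) (Sigma U ?TM)" if c: "(U, c) \<in> charts M" for U c
    using inj_onD[OF chart_inj_on[OF M c]]
      inj_onD[OF bij_betw_imp_inj_on[OF bij_betw_tangent_coord[OF M c]]]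
    by (intro inj_onI) fastforce
  have dom: "?chart c ` {x \<in> Sigma U ?TM. tangent_map N F x \<in> Sigma V ?TN} =
      c ` {p\<in>U. F p \<in> V} \<times> UNIV"
    if c: "(U, c) \<in> charts M" for U c V
  proof -
    have "{x \<in> Sigma U ?TM. tangent_map N F x \<in> Sigma V ?TN} = Sigma {p\<in>U. F p \<in> V} ?TM"
      using differential_in_tangent_space[OF M N F] by (auto simp: tangent_map_def)
    moreover have "(c p, w) \<in> ?chart c ` Sigma {p\<in>U. F p \<in> V} ?TM" if p: "p \<in> U" "F p \<in> V" for p w
    proof -
      obtain v where "v \<in> ?TM p" "w = tangent_coord c v"
        using bij_betw_imp_surj_on[OF bij_betw_tangent_coord[OF M c p(1)]] by blast
      then show ?thesis using p by force
    qed
    ultimately show ?thesis by auto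
  qed
  have op: "open (c ` {p\<in>U. F p \<in> V})" if "(U, c) \<in> charts M" "(V, d) \<in> charts N" for U c V d
    by (rule open_chart_preimage[OF M that(1) smooth_map_continuous[OF F] chart_openin[OF N that(2)]])
  have rep: "smooth_on (c ` {p\<in>U. F p \<in> V} \<times> UNIV)
      (local_rep (Sigma U ?TM) (?chart c) (?chart d) (tangent_map N F))"
    if c: "(U, c) \<in> charts M" and d: "(V, d) \<in> charts N" for U c V d
  proof (rule smooth_on_cong[OF _ _ smooth_on_derivative_pair[OF op[OF c d]
          smooth_map_local_rep[OF F c d]]])
    show "open (c ` {p\<in>U. F p \<in> V} \<times> (UNIV :: 'e set))" by (simp add: op[OF c d] open_Times)
    fix z :: "'e \<times> 'e" assume "z \<in> c ` {p\<in>U. F p \<in> V} \<times> UNIV"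
    then obtain p v where pv: "p \<in> U" "F p \<in> V" "v \<in> ?TM p" "z = ?chart c (p, v)"
      unfolding dom[OF c, symmetric] by (auto simp: tangent_map_def)
    have "inv_into (Sigma U ?TM) (?chart c) z = (p, v)"
      unfolding pv(4) by (rule inv_into_f_f[OF inj[OF c]]) (use pv in auto)
    then show "(case z of (x, w) \<Rightarrow> (local_rep U c d F x, frechet_derivative (local_rep U c d F) (at x) w))
        = local_rep (Sigma U ?TM) (?chart c) (?chart d) (tangent_map N F) z"
      using pv tangent_coord_differential[OF M N F c pv(1) d pv(2,3)] chart_inj_on[OF M c]
      by (simp add: tangent_map_def)
  qed
  show ?thesis
    unfolding tangent_bundle_def
  proof (rule smooth_map_manifold_of_charts, goal_cases)
    case (1 U c x)
    then obtain U' c' where c: "(U', c') \<in> charts M" "fst x \<in> U'" and x: "snd x \<in> ?TM (fst x)" by auto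
    then have "F (fst x) \<in> points N"
      using smooth_map_points[OF F] chart_subset_points[OF M c(1)] by blast
    then obtain V d where d: "(V, d) \<in> charts N" "F (fst x) \<in> V" using chart_at[OF N] by blast
    have "tangent_map N F x \<in> Sigma V ?TN"
      using d(2) differential_in_tangent_space[OF M N F x]
      by (simp add: tangent_map_def case_prod_beta)
    then show ?case using d(1) by blast
  next
    case (2 U c)
    then show ?case using inj by blast
  next
    case (3 TU C TV D)
    then obtain U c V d where c: "(U, c) \<in> charts M" "TU = Sigma U ?TM" "C = ?chart c"
      and d: "(V, d) \<in> charts N" "TV = Sigma V ?TN" "D = ?chart d" by blast
    show ?case unfolding c(2,3) d(2,3) dom[OF c(1)] by (intro open_Times op[OF c(1) d(1)] open_UNIV)
  next
    case (4 TU C TV D)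
    then obtain U c V d where c: "(U, c) \<in> charts M" "TU = Sigma U ?TM" "C = ?chart c"
      and d: "(V, d) \<in> charts N" "TV = Sigma V ?TN" "D = ?chart d" by blast
    show ?case unfolding c(2,3) d(2,3) dom[OF c(1)] by (rule rep[OF c(1) d(1)])
  qed
qed

text \<open>The coordinate expression between two tangent spaces is the derivative of the coordinate
  expression of \<open>F\<close> at one point, which is a bounded linear map.\<close>

lemma smooth_map_differential:
  fixes M :: "('a, 'e::finite_dim_inner) manifold" and N :: "('b, 'f::finite_dim_inner) manifold"
  assumes M: "smooth_manifold M" and N: "smooth_manifold N" and F: "smooth_map M N F"
    and p: "p \<in> points M"
  shows "smooth_map (tangent_space_manifold M p) (tangent_space_manifold N (F p)) (differential N F p)"
proof -
  let ?T = "tangent_space M p" and ?T' = "tangent_space N (F p)" and ?D = "differential N F p"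
  have dom: "tangent_coord c ` {v \<in> ?T. ?D v \<in> ?T'} = UNIV"
    if c: "(U, c) \<in> charts M" "p \<in> U" for U c
  proof -
    have "{v \<in> ?T. ?D v \<in> ?T'} = ?T" using differential_in_tangent_space[OF M N F] by blast
    then show ?thesis using bij_betw_imp_surj_on[OF bij_betw_tangent_coord[OF M c]] by simp
  qed
  have rep: "smooth_on UNIV (local_rep ?T (tangent_coord c) (tangent_coord d) ?D)"
    if c: "(U, c) \<in> charts M" "p \<in> U" and d: "(V, d) \<in> charts N" "F p \<in> V" for U c V d
  proof -
    have "(local_rep U c d F has_derivative frechet_derivative (local_rep U c d F) (at (c p))) (at (c p))"
      using smooth_on_has_derivative[OF smooth_map_local_rep[OF F c(1) d(1)]] c(2) d(2) by blast
    from smooth_on_bounded_linear[OF has_derivative_bounded_linear[OF this] open_UNIV]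
    show ?thesis
    proof (rule smooth_on_cong[OF open_UNIV, rotated])
      fix w
      note bij = bij_betw_tangent_coord[OF M c]
      have "inv_into ?T (tangent_coord c) w \<in> ?T" "tangent_coord c (inv_into ?T (tangent_coord c) w) = w"
        using bij_betw_imp_surj_on[OF bij] by (simp_all add: inv_into_into f_inv_into_f)
      then show "frechet_derivative (local_rep U c d F) (at (c p)) w =
          local_rep ?T (tangent_coord c) (tangent_coord d) ?D w"
        using tangent_coord_differential[OF M N F c d] by simp
    qed
  qed
  show ?thesis
    unfolding tangent_space_manifold_def
  proof (rule smooth_map_manifold_of_charts, goal_cases)
    case (1 U c v)
    obtain V d where "(V, d) \<in> charts N" "F p \<in> V"
      using chart_at[OF N smooth_map_points[OF F p]] .
    then show ?case using 1 differential_in_tangent_space[OF M N F] by blast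
  next
    case (2 U c)
    then show ?case using bij_betw_imp_inj_on[OF bij_betw_tangent_coord[OF M]] by blast
  next
    case (3 S C S' D)
    then obtain U c where c: "(U, c) \<in> charts M" "p \<in> U" "S = ?T" "C = tangent_coord c"
      and S': "S' = ?T'" by blast
    show ?case unfolding c(3,4) S' dom[OF c(1,2)] by (rule open_UNIV)
  next
    case (4 S C S' D)
    then obtain U c V d where c: "(U, c) \<in> charts M" "p \<in> U" "S = ?T" "C = tangent_coord c"
      and d: "(V, d) \<in> charts N" "F p \<in> V" "S' = ?T'" "D = tangent_coord d" by blast
    show ?case unfolding c(3,4) d(3,4) dom[OF c(1,2)] by (rule rep[OF c(1,2) d(1,2)])
  qed
qed

lemma tangent_bundle_points: "points (tangent_bundle N) \<subseteq> (SIGMA p:points N. tangent_space N p)"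
proof
  fix x assume "x \<in> points (tangent_bundle N)"
  then obtain U where "x \<in> Sigma U (tangent_space N)"
    unfolding tangent_bundle_def topspace_manifold_of_charts by blast
  then have v: "snd x \<in> tangent_space N (fst x)" by auto
  obtain \<gamma> where "\<gamma> \<in> curves_at N (fst x)" by (rule tangent_classE[OF v])
  then show "x \<in> (SIGMA p:points N. tangent_space N p)"
    using curves_at_in_points v by (cases x) auto
qed

theorem theorem3p9:
  fixes M :: "('a, 'e::finite_dim_inner) manifold"
    and N :: "('b, 'f::finite_dim_inner) manifold"
    and \<phi> :: "'b \<Rightarrow> 'a"
    and \<rho> :: "'a \<Rightarrow> 'b"
  assumes "smooth_manifold M"
    and "smooth_manifold N"
    and "smooth_embedding N M \<phi>"
    and "point_reduction M N \<phi> \<rho>"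
  shows "(\<forall>p\<in>points N. \<forall>v\<in>tangent_space N p.
            differential N \<rho> (\<phi> p) (differential M \<phi> p v) = v) \<and>
         reduction_map M N \<phi> (R_MPG N \<rho>)"
proof -
  note M = assms(1) and N = assms(2)
  have \<phi>: "smooth_map N M \<phi>"
    using assms(3) unfolding smooth_embedding_def smooth_immersion_def by blast
  have \<rho>: "smooth_map M N \<rho>" and \<rho>\<phi>: "\<And>p. p \<in> points N \<Longrightarrow> \<rho> (\<phi> p) = p"
    using assms(4) unfolding point_reduction_def by blast+
  have left_inv: "differential N \<rho> (\<phi> p) (differential M \<phi> p v) = v"
    if v: "v \<in> tangent_space N p" for p v
  proof -
    have "differential N \<rho> (\<phi> p) (differential M \<phi> p v) = differential N (\<rho> \<circ> \<phi>) p v"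
      by (rule differential_compose[OF N M N \<phi> \<rho> v])
    also have "\<dots> = v"
      by (rule differential_identity[OF N smooth_map_compose[OF N M N \<phi> \<rho>] _ v]) (simp add: \<rho>\<phi>)
    finally show ?thesis .
  qed
  have R: "R_MPG N \<rho> = tangent_map N \<rho>"
    unfolding R_MPG_def tangent_map_def by (rule refl)
  have "R_MPG N \<rho> (tangent_map M \<phi> x) = x" if x: "x \<in> points (tangent_bundle N)" for x
  proof -
    obtain p v where "x = (p, v)" "p \<in> points N" "v \<in> tangent_space N p"
      using subsetD[OF tangent_bundle_points x] by blast
    then show ?thesis unfolding R tangent_map_def by (simp add: left_inv \<rho>\<phi>)
  qed
  moreover have "smooth_map (tangent_bundle M) (tangent_bundle N) (R_MPG N \<rho>)"
    unfolding R by (rule smooth_map_tangent_map[OF M N \<rho>])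
  moreover have "\<forall>m\<in>points M.
      smooth_map (tangent_space_manifold M m) (tangent_space_manifold N (\<rho> m)) (differential N \<rho> m) \<and>
      (\<forall>v\<in>tangent_space M m. R_MPG N \<rho> (m, v) = (\<rho> m, differential N \<rho> m v))"
    using smooth_map_differential[OF M N \<rho>] unfolding R tangent_map_def by simp
  ultimately have "reduction_map M N \<phi> (R_MPG N \<rho>)"
    using \<rho> unfolding reduction_map_def by blast
  then show ?thesis using left_inv by blast
qed

end
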